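(* Let $\varphi:\mathfrak{g}\to\mathfrak{q}$ be a homomorphism of Leibniz algebras over $\mathbb{K}$ such that $\varphi(\mathfrak{m})\subseteq\mathfrak{n}$, where $\mathfrak{m}$ is a two-sided ideal of $\mathfrak{g}$ and $\mathfrak{n}$ is a two-sided ideal of $\mathfrak{q}$, and suppose the following properties hold: (a) the induced homomorphism $HL^{\mathrm{Lie}}_1(\mathfrak{g})\to HL^{\mathrm{Lie}}_1(\mathfrak{q})$ is an isomorphism; (b) the induced homomorphism $HL^{\mathrm{Lie}}_2(\mathfrak{g})\to HL^{\mathrm{Lie}}_2(\mathfrak{q})$ is an epimorphism; (c) the induced homomorphism $\varphi_1:\mathfrak{g}/\mathfrak{m}\to\mathfrak{q}/\mathfrak{n}$ is an isomorphism. Then $\varphi$ induces a natural isomorphism $\varphi_k:\mathfrak{g}/\mathfrak{m}^{[k]}\to\mathfrak{q}/\mathfrak{n}^{[k]}$ for every $k\ge1$.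
   Context: $\mathbb{K}$ is a field with $\frac12\in\mathbb{K}$. A Leibniz algebra is a $\mathbb{K}$-vector space with a bilinear bracket satisfying $[x,[y,z]]=[[x,y],z]-[[x,z],y]$. $\mathfrak{q}^{\mathrm{ann}}$ is the span of all $[x,x]$, $x\in\mathfrak{q}$ (a two-sided ideal), $\mathfrak{q}_{\mathrm{Lie}}=\mathfrak{q}/\mathfrak{q}^{\mathrm{ann}}$. For two-sided ideals $\mathfrak{m},\mathfrak{n}$ of $\mathfrak{q}$, $[\mathfrak{m},\mathfrak{n}]_{\mathrm{Lie}}$ is the span of all $[m,n]+[n,m]$, $m\in\mathfrak{m}$, $n\in\mathfrak{n}$ (a two-sided ideal). For a two-sided ideal $\mathfrak{n}$ of $\mathfrak{q}$, the lower $\mathrm{Lie}$-central series of $\mathfrak{q}$ relative to $\mathfrak{n}$ is $\mathfrak{n}^{[1]}=\mathfrak{n}$, $\mathfrak{n}^{[i]}=[\mathfrak{n}^{[i-1]},\mathfrak{q}]_{\mathrm{Lie}}$ for $i\ge2$ (similarly $\mathfrak{m}^{[i]}$ is formed in $\mathfrak{g}$); if $\varphi(\mathfrak{m})\subseteq\mathfrak{n}$ then $\varphi(\mathfrak{m}^{[i]})\subseteq\mathfrak{n}^{[i]}$. $HL^{\mathrm{Lie}}_1(\mathfrak{q})=\mathfrak{q}_{\mathrm{Lie}}$, and $HL^{\mathrm{Lie}}_2(\mathfrak{q})=(\mathfrak{r}\cap[\mathfrak{f},\mathfrak{f}]_{\mathrm{Lie}})/[\mathfrak{r},\mathfrak{f}]_{\mathrm{Lie}}$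 for any free presentation $0\to\mathfrak{r}\to\mathfrak{f}\to\mathfrak{q}\to0$ ($\mathfrak{f}$ a free Leibniz algebra); this is independent of the presentation up to canonical isomorphism and functorial in $\mathfrak{q}$ (lift a homomorphism to the free presentations). *)

theory Defs
  imports Complex_Main
begin

locale leibniz_algebra = vector_space scale
  for scale :: "'k::field \<Rightarrow> 'a::ab_group_add \<Rightarrow> 'a" +
  fixes bracket :: "'a \<Rightarrow> 'a \<Rightarrow> 'a"
  assumes bracket_add_left: "bracket (x + y) z = bracket x z + bracket y z"
    and bracket_add_right: "bracket x (y + z) = bracket x y + bracket x z"
    and bracket_scale_left: "bracket (scale c x) y = scale c (bracket x y)"
    and bracket_scale_right: "bracket x (scale c y) = scale c (bracket x y)"
    and leibniz_identity:
      "bracket x (bracket y z) = bracket (bracket x y) z - bracket (bracket x z) y"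

definition leibniz_hom ::
  "('k::field \<Rightarrow> 'a::ab_group_add \<Rightarrow> 'a) \<Rightarrow> ('a \<Rightarrow> 'a \<Rightarrow> 'a) \<Rightarrow>
   ('k \<Rightarrow> 'b::ab_group_add \<Rightarrow> 'b) \<Rightarrow> ('b \<Rightarrow> 'b \<Rightarrow> 'b) \<Rightarrow> ('a \<Rightarrow> 'b) \<Rightarrow> bool" where
  "leibniz_hom s b s' b' f \<longleftrightarrow>
     Vector_Spaces.linear s s' f \<and> (\<forall>x y. f (b x y) = b' (f x) (f y))"

definition two_sided_ideal ::
  "('k::field \<Rightarrow> 'a::ab_group_add \<Rightarrow> 'a) \<Rightarrow> ('a \<Rightarrow> 'a \<Rightarrow> 'a) \<Rightarrow> 'a set \<Rightarrow> bool" where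
  "two_sided_ideal s b I \<longleftrightarrow>
     module.subspace s I \<and> (\<forall>x\<in>I. \<forall>y. b x y \<in> I \<and> b y x \<in> I)"

definition leibniz_ann ::
  "('k::field \<Rightarrow> 'a::ab_group_add \<Rightarrow> 'a) \<Rightarrow> ('a \<Rightarrow> 'a \<Rightarrow> 'a) \<Rightarrow> 'a set" where
  "leibniz_ann s b = module.span s {b x x | x. True}"

definition Lie_commutator ::
  "('k::field \<Rightarrow> 'a::ab_group_add \<Rightarrow> 'a) \<Rightarrow> ('a \<Rightarrow> 'a \<Rightarrow> 'a) \<Rightarrow> 'a set \<Rightarrow> 'a set \<Rightarrow> 'a set" where
  "Lie_commutator s b M N = module.span s {b x y + b y x | x y. x \<in> M \<and> y \<in> N}"

text \<open>The series starts at index 1; the value at index 0 is a dummy.\<close>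

fun lower_Lie_central ::
  "('k::field \<Rightarrow> 'a::ab_group_add \<Rightarrow> 'a) \<Rightarrow> ('a \<Rightarrow> 'a \<Rightarrow> 'a) \<Rightarrow> 'a set \<Rightarrow> nat \<Rightarrow> 'a set" where
  "lower_Lie_central s b N 0 = UNIV"
| "lower_Lie_central s b N (Suc 0) = N"
| "lower_Lie_central s b N (Suc (Suc i)) =
     Lie_commutator s b (lower_Lie_central s b N (Suc i)) UNIV"

text \<open>
  Quotients are algebras whose elements are cosets, so they need an explicit carrier.
  Each operation is the union of the cosets obtained from all choices of representatives,
  which is a single coset when the operation is well defined on cosets; the same encoding
  is used for the map induced by a homomorphism.
\<close>

record ('k, 'v) algebra_on =
  carrier :: "'v set"
  add_on :: "'v \<Rightarrow> 'v \<Rightarrow> 'v"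
  scale_on :: "'k \<Rightarrow> 'v \<Rightarrow> 'v"
  bracket_on :: "'v \<Rightarrow> 'v \<Rightarrow> 'v"

definition algebra_hom ::
  "('k, 'v) algebra_on \<Rightarrow> ('k, 'w) algebra_on \<Rightarrow> ('v \<Rightarrow> 'w) \<Rightarrow> bool" where
  "algebra_hom A B f \<longleftrightarrow>
     (\<forall>x\<in>carrier A. f x \<in> carrier B) \<and>
     (\<forall>x\<in>carrier A. \<forall>y\<in>carrier A. f (add_on A x y) = add_on B (f x) (f y)) \<and>
     (\<forall>c. \<forall>x\<in>carrier A. f (scale_on A c x) = scale_on B c (f x)) \<and>
     (\<forall>x\<in>carrier A. \<forall>y\<in>carrier A. f (bracket_on A x y) = bracket_on B (f x) (f y))"

definition algebra_iso ::
  "('k, 'v) algebra_on \<Rightarrow> ('k, 'w) algebra_on \<Rightarrow> ('v \<Rightarrow> 'w) \<Rightarrow> bool" where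
  "algebra_iso A B f \<longleftrightarrow> algebra_hom A B f \<and> bij_betw f (carrier A) (carrier B)"

definition algebra_epi ::
  "('k, 'v) algebra_on \<Rightarrow> ('k, 'w) algebra_on \<Rightarrow> ('v \<Rightarrow> 'w) \<Rightarrow> bool" where
  "algebra_epi A B f \<longleftrightarrow> algebra_hom A B f \<and> f ` carrier A = carrier B"

definition coset :: "'a::ab_group_add set \<Rightarrow> 'a \<Rightarrow> 'a set" where
  "coset I x = (\<lambda>y. x + y) ` I"

text \<open>The subquotient \<open>A / I\<close>, for \<open>I \<subseteq> A\<close>.\<close>

definition quotient_alg ::
  "('k::field \<Rightarrow> 'a::ab_group_add \<Rightarrow> 'a) \<Rightarrow> ('a \<Rightarrow> 'a \<Rightarrow> 'a) \<Rightarrow>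
   'a set \<Rightarrow> 'a set \<Rightarrow> ('k, 'a set) algebra_on" where
  "quotient_alg s b A I =
     \<lparr> carrier = coset I ` A,
       add_on = (\<lambda>C D. \<Union>x\<in>C. \<Union>y\<in>D. coset I (x + y)),
       scale_on = (\<lambda>c C. \<Union>x\<in>C. coset I (s c x)),
       bracket_on = (\<lambda>C D. \<Union>x\<in>C. \<Union>y\<in>D. coset I (b x y)) \<rparr>"

definition induced_map :: "('a \<Rightarrow> 'b::ab_group_add) \<Rightarrow> 'b set \<Rightarrow> 'a set \<Rightarrow> 'b set" where
  "induced_map f J C = (\<Union>x\<in>C. coset J (f x))"

lemma induced_map_coset:
  assumes "leibniz_hom s b s' b' f" "two_sided_ideal s b I" "two_sided_ideal s' b' J"
    "f ` I \<subseteq> J"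
  shows "induced_map f J (coset I x) = coset J (f x)"
proof -
  interpret h: Vector_Spaces.linear s s' f using assms(1) by (simp add: leibniz_hom_def)
  have J: "h.vs2.subspace J" and I: "h.vs1.subspace I"
    using assms by (auto simp: two_sided_ideal_def)
  have *: "coset J (f (x + i)) = coset J (f x)" if "i \<in> I" for i
  proof -
    have fi: "f i \<in> J" using that assms(4) by auto
    show ?thesis unfolding coset_def h.add
    proof safe
      fix y assume "y \<in> J"
      then have "f i + y \<in> J" using fi J h.vs2.subspace_add by blast
      then show "f x + f i + y \<in> (+) (f x) ` J" by (auto simp: add.assoc)
    next
      fix y assume "y \<in> J"
      then have "y - f i \<in> J" using fi J h.vs2.subspace_diff by blast
      moreover have "f x + y = f x + f i + (y - f i)" by simp
      ultimately show "f x + y \<in> (+) (f x + f i) ` J" by blast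
    qed
  qed
  have "0 \<in> I" using I h.vs1.subspace_0 by blast
  have "induced_map f J (coset I x) = (\<Union>i\<in>I. coset J (f (x + i)))"
    by (auto simp: induced_map_def coset_def)
  also have "\<dots> = (\<Union>i\<in>I. coset J (f x))" using * by simp
  also have "\<dots> = coset J (f x)" using \<open>0 \<in> I\<close> by auto
  finally show ?thesis .
qed

text \<open>
  The free Leibniz algebra on a set of generators, realised as the type of terms in the
  operations of a Leibniz algebra modulo the congruence generated by its axioms.
\<close>

datatype ('k, 'x) leibniz_term =
    Gen 'x
  | Zero
  | Add "('k, 'x) leibniz_term" "('k, 'x) leibniz_term"
  | Scale 'k "('k, 'x) leibniz_term"
  | Brk "('k, 'x) leibniz_term" "('k, 'x) leibniz_term"

inductive leibniz_eq ::
  "('k::field, 'x) leibniz_term \<Rightarrow> ('k, 'x) leibniz_term \<Rightarrow> bool" where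
  refl: "leibniz_eq t t"
| sym: "leibniz_eq t u \<Longrightarrow> leibniz_eq u t"
| trans: "leibniz_eq t u \<Longrightarrow> leibniz_eq u v \<Longrightarrow> leibniz_eq t v"
| Add_cong: "leibniz_eq t t' \<Longrightarrow> leibniz_eq u u' \<Longrightarrow> leibniz_eq (Add t u) (Add t' u')"
| Scale_cong: "leibniz_eq t t' \<Longrightarrow> leibniz_eq (Scale c t) (Scale c t')"
| Brk_cong: "leibniz_eq t t' \<Longrightarrow> leibniz_eq u u' \<Longrightarrow> leibniz_eq (Brk t u) (Brk t' u')"
| Add_assoc: "leibniz_eq (Add (Add t u) v) (Add t (Add u v))"
| Add_comm: "leibniz_eq (Add t u) (Add u t)"
| Add_Zero: "leibniz_eq (Add Zero t) t"
| Add_inverse: "leibniz_eq (Add (Scale (- 1) t) t) Zero"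
| Scale_Add: "leibniz_eq (Scale c (Add t u)) (Add (Scale c t) (Scale c u))"
| Scale_plus: "leibniz_eq (Scale (c + d) t) (Add (Scale c t) (Scale d t))"
| Scale_Scale: "leibniz_eq (Scale c (Scale d t)) (Scale (c * d) t)"
| Scale_one: "leibniz_eq (Scale 1 t) t"
| Brk_Add_left: "leibniz_eq (Brk (Add t u) v) (Add (Brk t v) (Brk u v))"
| Brk_Add_right: "leibniz_eq (Brk t (Add u v)) (Add (Brk t u) (Brk t v))"
| Brk_Scale_left: "leibniz_eq (Brk (Scale c t) u) (Scale c (Brk t u))"
| Brk_Scale_right: "leibniz_eq (Brk t (Scale c u)) (Scale c (Brk t u))"
| Leibniz: "leibniz_eq (Brk t (Brk u v)) (Add (Brk (Brk t u) v) (Scale (- 1) (Brk (Brk t v) u)))"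

quotient_type (overloaded) ('k, 'x) free_leibniz = "('k::field, 'x) leibniz_term" / leibniz_eq
proof (rule equivpI)
  show "reflp (leibniz_eq :: ('k, 'x) leibniz_term \<Rightarrow> _)" by (rule reflpI) (rule leibniz_eq.refl)
  show "symp (leibniz_eq :: ('k, 'x) leibniz_term \<Rightarrow> _)" by (rule sympI) (rule leibniz_eq.sym)
  show "transp (leibniz_eq :: ('k, 'x) leibniz_term \<Rightarrow> _)" by (rule transpI) (rule leibniz_eq.trans)
qed

lift_definition free_gen :: "'x \<Rightarrow> ('k::field, 'x) free_leibniz" is Gen .

lift_definition free_scale :: "'k::field \<Rightarrow> ('k, 'x) free_leibniz \<Rightarrow> ('k, 'x) free_leibniz"
  is Scale by (rule leibniz_eq.Scale_cong)

lift_definition free_bracket ::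
  "('k::field, 'x) free_leibniz \<Rightarrow> ('k, 'x) free_leibniz \<Rightarrow> ('k, 'x) free_leibniz"
  is Brk by (rule leibniz_eq.Brk_cong)

instantiation free_leibniz :: (field, type) ab_group_add
begin

lift_definition zero_free_leibniz :: "('a, 'b) free_leibniz" is Zero .

lift_definition plus_free_leibniz ::
  "('a, 'b) free_leibniz \<Rightarrow> ('a, 'b) free_leibniz \<Rightarrow> ('a, 'b) free_leibniz"
  is Add by (rule leibniz_eq.Add_cong)

definition uminus_free_leibniz :: "('a, 'b) free_leibniz \<Rightarrow> ('a, 'b) free_leibniz" where
  "- t = free_scale (- 1) t"

definition minus_free_leibniz ::
  "('a, 'b) free_leibniz \<Rightarrow> ('a, 'b) free_leibniz \<Rightarrow> ('a, 'b) free_leibniz" where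
  "t - u = t + - (u :: ('a, 'b) free_leibniz)"

instance
proof
  fix t u v :: "('a, 'b) free_leibniz"
  show "t + u + v = t + (u + v)" by transfer (rule leibniz_eq.Add_assoc)
  show "t + u = u + t" by transfer (rule leibniz_eq.Add_comm)
  show "0 + t = t" by transfer (rule leibniz_eq.Add_Zero)
  show "- t + t = 0" unfolding uminus_free_leibniz_def by transfer (rule leibniz_eq.Add_inverse)
  show "t - u = t + - u" by (rule minus_free_leibniz_def)
qed

end

lemma leibniz_algebra_free:
  "leibniz_algebra (free_scale :: 'k::field \<Rightarrow> ('k, 'x) free_leibniz \<Rightarrow> _) free_bracket"
proof
  fix c d :: 'k and t u v :: "('k, 'x) free_leibniz"
  show "free_scale c (t + u) = free_scale c t + free_scale c u"
    by transfer (rule leibniz_eq.Scale_Add)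
  show "free_scale (c + d) t = free_scale c t + free_scale d t"
    by transfer (rule leibniz_eq.Scale_plus)
  show "free_scale c (free_scale d t) = free_scale (c * d) t"
    by transfer (rule leibniz_eq.Scale_Scale)
  show "free_scale 1 t = t"
    by transfer (rule leibniz_eq.Scale_one)
  show "free_bracket (t + u) v = free_bracket t v + free_bracket u v"
    by transfer (rule leibniz_eq.Brk_Add_left)
  show "free_bracket t (u + v) = free_bracket t u + free_bracket t v"
    by transfer (rule leibniz_eq.Brk_Add_right)
  show "free_bracket (free_scale c t) u = free_scale c (free_bracket t u)"
    by transfer (rule leibniz_eq.Brk_Scale_left)
  show "free_bracket t (free_scale c u) = free_scale c (free_bracket t u)"
    by transfer (rule leibniz_eq.Brk_Scale_right)
  show "free_bracket t (free_bracket u v) =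
      free_bracket (free_bracket t u) v - free_bracket (free_bracket t v) u"
    unfolding minus_free_leibniz_def uminus_free_leibniz_def
    by transfer (rule leibniz_eq.Leibniz)
qed

primrec term_interp ::
  "('k::field \<Rightarrow> 'a::ab_group_add \<Rightarrow> 'a) \<Rightarrow> ('a \<Rightarrow> 'a \<Rightarrow> 'a) \<Rightarrow> ('x \<Rightarrow> 'a) \<Rightarrow>
   ('k, 'x) leibniz_term \<Rightarrow> 'a" where
  "term_interp s b h (Gen x) = h x"
| "term_interp s b h Zero = 0"
| "term_interp s b h (Add t u) = term_interp s b h t + term_interp s b h u"
| "term_interp s b h (Scale c t) = s c (term_interp s b h t)"
| "term_interp s b h (Brk t u) = b (term_interp s b h t) (term_interp s b h u)"

lemma (in leibniz_algebra) term_interp_cong: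
  "leibniz_eq t u \<Longrightarrow> term_interp scale bracket h t = term_interp scale bracket h u"
proof (induction rule: leibniz_eq.induct)
  case (Add_comm t u)
  then show ?case by (simp add: add.commute)
qed (simp_all add: bracket_add_left bracket_add_right bracket_scale_left bracket_scale_right
      leibniz_identity scale_right_distrib scale_left_distrib add.assoc)

text \<open>The universal property of the free Leibniz algebra.\<close>

theorem free_leibniz_universal:
  fixes s :: "'k::field \<Rightarrow> 'a::ab_group_add \<Rightarrow> 'a" and h :: "'x \<Rightarrow> 'a"
  assumes "leibniz_algebra s b"
  shows "\<exists>!f. leibniz_hom free_scale free_bracket s b f \<and> (\<forall>x. f (free_gen x) = h x)"
proof (rule ex_ex1I)
  interpret A: leibniz_algebra s b by fact
  interpret F: leibniz_algebra "free_scale :: 'k \<Rightarrow> ('k, 'x) free_leibniz \<Rightarrow> _" free_bracket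
    by (rule leibniz_algebra_free)
  define f where "f t = term_interp s b h (rep_free_leibniz t)" for t
  have abs: "f (abs_free_leibniz t) = term_interp s b h t" for t
    unfolding f_def
    by (rule A.term_interp_cong) (metis Quotient_rep_abs Quotient_free_leibniz leibniz_eq.refl)
  have add: "f (t + u) = f t + f u" for t u
    by (induct t rule: free_leibniz.abs_induct, induct u rule: free_leibniz.abs_induct)
      (simp add: plus_free_leibniz.abs_eq abs)
  have scale: "f (free_scale c t) = s c (f t)" for c t
    by (induct t rule: free_leibniz.abs_induct) (simp add: free_scale.abs_eq abs)
  have br: "f (free_bracket t u) = b (f t) (f u)" for t u
    by (induct t rule: free_leibniz.abs_induct, induct u rule: free_leibniz.abs_induct)
      (simp add: free_bracket.abs_eq abs)
  have "Vector_Spaces.linear free_scale s f"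
    by unfold_locales (auto simp: add scale)
  moreover have "f (free_gen x) = h x" for x
    by (simp add: free_gen.abs_eq abs)
  ultimately show "\<exists>f. leibniz_hom free_scale free_bracket s b f \<and> (\<forall>x. f (free_gen x) = h x)"
    using br by (auto simp: leibniz_hom_def)
next
  fix f g
  assume f: "leibniz_hom free_scale free_bracket s b f \<and> (\<forall>x. f (free_gen x) = h x)"
    and g: "leibniz_hom free_scale free_bracket s b g \<and> (\<forall>x. g (free_gen x) = h x)"
  interpret f: Vector_Spaces.linear free_scale s f using f by (simp add: leibniz_hom_def)
  interpret g: Vector_Spaces.linear free_scale s g using g by (simp add: leibniz_hom_def)
  have "f (abs_free_leibniz t) = g (abs_free_leibniz t)" for t
  proof (induction t)
    case (Gen x)
    then show ?case using f g by (simp flip: free_gen.abs_eq)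
  next
    case Zero
    then show ?case by (simp flip: zero_free_leibniz.abs_eq)
  next
    case (Add t u)
    then show ?case by (simp flip: plus_free_leibniz.abs_eq add: f.add g.add)
  next
    case (Scale c t)
    then show ?case by (simp flip: free_scale.abs_eq add: f.scale g.scale)
  next
    case (Brk t u)
    then show ?case using f g by (simp flip: free_bracket.abs_eq add: leibniz_hom_def)
  qed
  then show "f = g"
    by (intro ext) (rule free_leibniz.abs_induct)
qed

definition free_presentation ::
  "('k::field \<Rightarrow> 'a::ab_group_add \<Rightarrow> 'a) \<Rightarrow> ('a \<Rightarrow> 'a \<Rightarrow> 'a) \<Rightarrow>
   (('k, 'x) free_leibniz \<Rightarrow> 'a) \<Rightarrow> bool" where
  "free_presentation s b \<epsilon> \<longleftrightarrow> leibniz_hom free_scale free_bracket s b \<epsilon> \<and> surj \<epsilon>"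

lemma ex_free_presentation:
  fixes s :: "'k::field \<Rightarrow> 'a::ab_group_add \<Rightarrow> 'a"
  assumes "leibniz_algebra s b"
  shows "\<exists>\<epsilon> :: ('k, 'a) free_leibniz \<Rightarrow> 'a. free_presentation s b \<epsilon>"
proof -
  obtain \<epsilon> :: "('k, 'a) free_leibniz \<Rightarrow> 'a"
    where "leibniz_hom free_scale free_bracket s b \<epsilon>" "\<forall>x. \<epsilon> (free_gen x) = x"
    using ex1_implies_ex[OF free_leibniz_universal[OF assms, of "\<lambda>x. x"]] by blast
  then show ?thesis unfolding free_presentation_def surj_def by metis
qed

text \<open>\<open>\<Phi>\<close> lifts the homomorphism \<open>\<phi>\<close> to the free presentations \<open>\<epsilon>\<close> and \<open>\<epsilon>'\<close>.\<close>

definition presentation_lift ::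
  "(('k::field, 'x) free_leibniz \<Rightarrow> 'a) \<Rightarrow> (('k, 'y) free_leibniz \<Rightarrow> 'b) \<Rightarrow> ('a \<Rightarrow> 'b) \<Rightarrow>
   (('k, 'x) free_leibniz \<Rightarrow> ('k, 'y) free_leibniz) \<Rightarrow> bool" where
  "presentation_lift \<epsilon> \<epsilon>' \<phi> \<Phi> \<longleftrightarrow>
     leibniz_hom free_scale free_bracket free_scale free_bracket \<Phi> \<and>
     (\<forall>t. \<epsilon>' (\<Phi> t) = \<phi> (\<epsilon> t))"

lemma ex_presentation_lift:
  fixes \<epsilon> :: "('k::field, 'x) free_leibniz \<Rightarrow> 'a::ab_group_add"
    and \<epsilon>' :: "('k, 'y) free_leibniz \<Rightarrow> 'b::ab_group_add"
  assumes "leibniz_algebra s' b'" "leibniz_hom s b s' b' \<phi>"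
    "free_presentation s b \<epsilon>" "free_presentation s' b' \<epsilon>'"
  shows "\<exists>\<Phi>. presentation_lift \<epsilon> \<epsilon>' \<phi> \<Phi>"
proof -
  have comp: "leibniz_hom s1 b1 s3 b3 (\<lambda>x. g (f x))"
    if "leibniz_hom s1 b1 s2 b2 f" "leibniz_hom s2 b2 s3 b3 g"
    for s1 :: "'k \<Rightarrow> 'c::ab_group_add \<Rightarrow> 'c" and s2 :: "'k \<Rightarrow> 'd::ab_group_add \<Rightarrow> 'd"
      and s3 :: "'k \<Rightarrow> 'e::ab_group_add \<Rightarrow> 'e" and b1 b2 b3 f g
    using that Vector_Spaces.linear_compose[of s1 s2 f s3 g]
    unfolding leibniz_hom_def o_def by simp
  have e: "leibniz_hom free_scale free_bracket s b \<epsilon>"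
    and e': "leibniz_hom free_scale free_bracket s' b' \<epsilon>'" and "surj \<epsilon>'"
    using assms by (auto simp: free_presentation_def)
  define h where "h x = (SOME t. \<epsilon>' t = \<phi> (\<epsilon> (free_gen x)))" for x
  have h: "\<epsilon>' (h x) = \<phi> (\<epsilon> (free_gen x))" for x
  proof -
    have "\<exists>t. \<epsilon>' t = \<phi> (\<epsilon> (free_gen x))" using \<open>surj \<epsilon>'\<close> by (metis surjD)
    then show ?thesis unfolding h_def by (rule someI_ex)
  qed
  obtain \<Phi> where \<Phi>: "leibniz_hom free_scale free_bracket free_scale free_bracket \<Phi>"
    and gen: "\<And>x. \<Phi> (free_gen x) = h x"
    using ex1_implies_ex[OF free_leibniz_universal[OF leibniz_algebra_free, of h]] by blast
  define P where "P f \<longleftrightarrow> leibniz_hom free_scale free_bracket s' b' f \<and>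
      (\<forall>x. f (free_gen x) = \<phi> (\<epsilon> (free_gen x)))" for f
  have U: "\<exists>!f. P f"
    unfolding P_def by (rule free_leibniz_universal[OF assms(1)])
  have uniq: "f = g" if "P f" "P g" for f g using U that by (auto elim: ex1E)
  have 1: "P (\<lambda>t. \<epsilon>' (\<Phi> t))"
    unfolding P_def using comp[OF \<Phi> e'] gen h by simp
  have 2: "P (\<lambda>t. \<phi> (\<epsilon> t))"
    unfolding P_def using comp[OF e assms(2)] by simp
  have "(\<lambda>t. \<epsilon>' (\<Phi> t)) = (\<lambda>t. \<phi> (\<epsilon> t))"
    by (rule uniq[OF 1 2])
  then have "\<epsilon>' (\<Phi> t) = \<phi> (\<epsilon> t)" for t by (rule fun_cong)
  then have "presentation_lift \<epsilon> \<epsilon>' \<phi> \<Phi>"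
    using \<Phi> by (simp add: presentation_lift_def)
  then show ?thesis by blast
qed

definition HL1_Lie ::
  "('k::field \<Rightarrow> 'a::ab_group_add \<Rightarrow> 'a) \<Rightarrow> ('a \<Rightarrow> 'a \<Rightarrow> 'a) \<Rightarrow> ('k, 'a set) algebra_on" where
  "HL1_Lie s b = quotient_alg s b UNIV (leibniz_ann s b)"

definition HL1_Lie_map ::
  "('k::field \<Rightarrow> 'b::ab_group_add \<Rightarrow> 'b) \<Rightarrow> ('b \<Rightarrow> 'b \<Rightarrow> 'b) \<Rightarrow> ('a \<Rightarrow> 'b) \<Rightarrow> 'a set \<Rightarrow> 'b set" where
  "HL1_Lie_map s' b' \<phi> = induced_map \<phi> (leibniz_ann s' b')"

text \<open>
  \<open>HL\<^sub>2\<close> is computed from a free presentation \<open>\<epsilon>\<close>, with \<open>\<rr> = ker \<epsilon>\<close>, and the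
  induced map from a lift of the homomorphism to the presentations.
\<close>

definition presentation_kernel :: "(('k::field, 'x) free_leibniz \<Rightarrow> 'a::zero) \<Rightarrow> ('k, 'x) free_leibniz set" where
  "presentation_kernel \<epsilon> = {t. \<epsilon> t = 0}"

definition HL2_Lie ::
  "(('k::field, 'x) free_leibniz \<Rightarrow> 'a::ab_group_add) \<Rightarrow> ('k, ('k, 'x) free_leibniz set) algebra_on" where
  "HL2_Lie \<epsilon> = quotient_alg free_scale free_bracket
     (presentation_kernel \<epsilon> \<inter> Lie_commutator free_scale free_bracket UNIV UNIV)
     (Lie_commutator free_scale free_bracket (presentation_kernel \<epsilon>) UNIV)"

definition HL2_Lie_map ::
  "(('k::field, 'y) free_leibniz \<Rightarrow> 'b::ab_group_add) \<Rightarrow>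
   (('k, 'x) free_leibniz \<Rightarrow> ('k, 'y) free_leibniz) \<Rightarrow>
   ('k, 'x) free_leibniz set \<Rightarrow> ('k, 'y) free_leibniz set" where
  "HL2_Lie_map \<epsilon>' \<Phi> =
     induced_map \<Phi> (Lie_commutator free_scale free_bracket (presentation_kernel \<epsilon>') UNIV)"

end

theory Submission imports Defs begin

text \<open>
  Write \<open>[M, N]\<close> for the \<open>Lie\<close>-commutator, the span of the symmetrised brackets. The proof is an
  induction on \<open>k\<close>: if \<open>\<phi>\<close> induces an isomorphism \<open>g/I \<cong> q/J\<close>, where \<open>I = m\<^sup>[\<^sup>k\<^sup>]\<close> and
  \<open>J = n\<^sup>[\<^sup>k\<^sup>]\<close>, then it induces an isomorphism \<open>g/[I, g] \<cong> q/[J, q]\<close>. Conceptually this is the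
  five lemma for the exact sequences
  \<open>HL\<^sub>2(g) \<rightarrow> HL\<^sub>2(g/I) \<rightarrow> I/[I, g] \<rightarrow> HL\<^sub>1(g) \<rightarrow> HL\<^sub>1(g/I) \<rightarrow> 0\<close> of \<open>g\<close> and \<open>q\<close>; the argument
  below chases elements instead of setting up the sequences. Since \<open>2\<close> is invertible, polarisation
  gives \<open>q\<^sup>a\<^sup>n\<^sup>n = [q, q]\<close>, so condition (a) is a statement about commutators.

  Surjectivity: by (a) each \<open>y\<close> in \<open>q\<close> is \<open>\<phi>(x) + a\<close> with \<open>a\<close> in \<open>[q, q]\<close>. Replacing the entries
  of the commutators in \<open>a\<close> by elements of \<open>\<phi>(g)\<close> congruent to them modulo \<open>J\<close> changes \<open>a\<close> only by
  an element of \<open>[J, q]\<close> (\<open>Lie_commutator_lift\<close>).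

  Injectivity: let \<open>\<phi>(x)\<close> lie in \<open>[J, q]\<close>. By (a), \<open>x\<close> is in \<open>[g, g]\<close>, so it lifts to some \<open>t\<close> in
  \<open>[f, f]\<close> for the free algebra \<open>f\<close> presenting \<open>g\<close>. Let \<open>f'\<close> be the one presenting \<open>q\<close>, and let
  \<open>s\<close>, \<open>s'\<close> be the preimages of \<open>I\<close>, \<open>J\<close> in \<open>f\<close>, \<open>f'\<close>. By (b), \<open>t\<close> can be corrected by a
  relation of \<open>g\<close> so that \<open>\<Phi>(t)\<close> lies in \<open>[s', f']\<close>. Now \<open>f/s \<cong> f'/s'\<close>, and because \<open>f'\<close> is free
  the inverse isomorphism lifts to a homomorphism \<open>\<psi>\<close> from \<open>f'\<close> to \<open>f\<close> that maps \<open>[s', f']\<close> into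
  \<open>[s, f]\<close>. Since \<open>\<psi> \<circ> \<Phi>\<close> is the identity modulo \<open>s\<close>, it is the identity modulo \<open>[s, f]\<close> on
  commutators, so \<open>t\<close> lies in \<open>[s, f]\<close> (\<open>Lie_commutator_reflect_free\<close>) and \<open>x\<close> in \<open>[I, g]\<close>
  (\<open>Lie_commutator_reflect\<close>).
\<close>

section \<open>Quotients and the maps between them\<close>

lemma (in module) coset_eq_iff:
  assumes "subspace I"
  shows "coset I x = coset I y \<longleftrightarrow> x - y \<in> I"
proof
  assume "coset I x = coset I y"
  moreover have "x \<in> coset I x"
    using subspace_0[OF assms] by (force simp: coset_def)
  ultimately obtain i where "i \<in> I" "x = y + i"
    by (auto simp: coset_def)
  then show "x - y \<in> I" by simp
next
  assume xy: "x - y \<in> I"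
  show "coset I x = coset I y"
    unfolding coset_def
  proof safe
    fix i assume "i \<in> I"
    then have "(x - y) + i \<in> I" using xy assms subspace_add by blast
    moreover have "x + i = y + ((x - y) + i)" by simp
    ultimately show "x + i \<in> (+) y ` I" by blast
  next
    fix i assume "i \<in> I"
    then have "i - (x - y) \<in> I" using xy assms subspace_diff by blast
    moreover have "y + i = x + (i - (x - y))" by simp
    ultimately show "y + i \<in> (+) x ` I" by blast
  qed
qed

lemma (in module) mem_coset_iff:
  assumes "subspace I"
  shows "y \<in> coset I x \<longleftrightarrow> y - x \<in> I"
  unfolding coset_def by (force simp: image_iff algebra_simps)

text \<open>The operations of a quotient are unions over all choices of representatives; for an ideal all
  the cosets in such a union agree.\<close>

lemma (in leibniz_algebra)
  assumes I: "two_sided_ideal scale bracket I"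
  shows add_on_coset:
      "add_on (quotient_alg scale bracket A I) (coset I x) (coset I y) = coset I (x + y)"
    and scale_on_coset:
      "scale_on (quotient_alg scale bracket A I) c (coset I x) = coset I (scale c x)"
    and bracket_on_coset:
      "bracket_on (quotient_alg scale bracket A I) (coset I x) (coset I y) = coset I (bracket x y)"
proof -
  have sub: "subspace I" and l: "\<And>i z. i \<in> I \<Longrightarrow> bracket i z \<in> I"
    and r: "\<And>i z. i \<in> I \<Longrightarrow> bracket z i \<in> I"
    using I by (auto simp: two_sided_ideal_def)
  have self: "z \<in> coset I z" for z
    using mem_coset_iff[OF sub] subspace_0[OF sub] by simp
  have "coset I (x' + y') = coset I (x + y)" if "x' \<in> coset I x" "y' \<in> coset I y" for x' y'
  proof -
    have "(x' + y') - (x + y) = (x' - x) + (y' - y)" by simp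
    also have "\<dots> \<in> I"
      using that by (intro subspace_add[OF sub]) (simp_all add: mem_coset_iff[OF sub])
    finally show ?thesis by (simp add: coset_eq_iff[OF sub])
  qed
  then have "(\<Union>x'\<in>coset I x. \<Union>y'\<in>coset I y. coset I (x' + y')) =
      (\<Union>x'\<in>coset I x. \<Union>y'\<in>coset I y. coset I (x + y))"
    by simp
  then show "add_on (quotient_alg scale bracket A I) (coset I x) (coset I y) = coset I (x + y)"
    using self by (auto simp: quotient_alg_def)
  have "coset I (scale c x') = coset I (scale c x)" if "x' \<in> coset I x" for x'
    using that subspace_scale[OF sub, of "x' - x" c]
    by (simp add: mem_coset_iff[OF sub] coset_eq_iff[OF sub] scale_right_diff_distrib)
  then have "(\<Union>x'\<in>coset I x. coset I (scale c x')) = (\<Union>x'\<in>coset I x. coset I (scale c x))"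
    by simp
  then show "scale_on (quotient_alg scale bracket A I) c (coset I x) = coset I (scale c x)"
    using self by (auto simp: quotient_alg_def)
  have "coset I (bracket x' y') = coset I (bracket x y)"
    if "x' \<in> coset I x" "y' \<in> coset I y" for x' y'
  proof -
    have "bracket ((x' - x) + x) y' = bracket (x' - x) y' + bracket x y'"
      "bracket x ((y' - y) + y) = bracket x (y' - y) + bracket x y"
      by (rule bracket_add_left, rule bracket_add_right)
    then have "bracket x' y' - bracket x y = bracket (x' - x) y' + bracket x (y' - y)"
      by simp
    then show ?thesis
      using that l[of "x' - x" y'] r[of "y' - y" x] subspace_add[OF sub]
      by (simp add: mem_coset_iff[OF sub] coset_eq_iff[OF sub])
  qed
  then have "(\<Union>x'\<in>coset I x. \<Union>y'\<in>coset I y. coset I (bracket x' y')) =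
      (\<Union>x'\<in>coset I x. \<Union>y'\<in>coset I y. coset I (bracket x y))"
    by simp
  then show "bracket_on (quotient_alg scale bracket A I) (coset I x) (coset I y) =
      coset I (bracket x y)"
    using self by (auto simp: quotient_alg_def)
qed

text \<open>All isomorphisms of quotients, given or to be proved, are handled in this elementwise form:
  injectivity and surjectivity modulo the ideals. Compatibility with the operations is automatic.\<close>

lemma algebra_iso_quotient_iff:
  assumes A: "leibniz_algebra s b" and B: "leibniz_algebra s' b'"
    and f: "leibniz_hom s b s' b' f"
    and I: "two_sided_ideal s b I" and J: "two_sided_ideal s' b' J"
    and fI: "f ` I \<subseteq> J"
  shows "algebra_iso (quotient_alg s b UNIV I) (quotient_alg s' b' UNIV J) (induced_map f J) \<longleftrightarrow>
    (\<forall>x. f x \<in> J \<longrightarrow> x \<in> I) \<and> (\<forall>y. \<exists>x. y - f x \<in> J)"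
proof -
  interpret A: leibniz_algebra s b by fact
  interpret B: leibniz_algebra s' b' by fact
  interpret f: Vector_Spaces.linear s s' f using f by (simp add: leibniz_hom_def)
  have subI: "A.subspace I" and subJ: "B.subspace J"
    using I J by (auto simp: two_sided_ideal_def)
  note ind = induced_map_coset[OF f I J fI]
  have carrier: "carrier (quotient_alg s b UNIV I) = range (coset I)"
    "carrier (quotient_alg s' b' UNIV J) = range (coset J)"
    by (auto simp: quotient_alg_def)
  have hom: "algebra_hom (quotient_alg s b UNIV I) (quotient_alg s' b' UNIV J) (induced_map f J)"
    using f unfolding algebra_hom_def carrier leibniz_hom_def
    by (auto simp: ind A.add_on_coset[OF I] B.add_on_coset[OF J] A.scale_on_coset[OF I]
        B.scale_on_coset[OF J] A.bracket_on_coset[OF I] B.bracket_on_coset[OF J] f.add f.scale)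
  have "inj_on (induced_map f J) (range (coset I)) \<longleftrightarrow> (\<forall>x y. f (x - y) \<in> J \<longrightarrow> x - y \<in> I)"
    by (auto simp: inj_on_def ind A.coset_eq_iff[OF subI] B.coset_eq_iff[OF subJ] f.diff)
  also have "\<dots> \<longleftrightarrow> (\<forall>x. f x \<in> J \<longrightarrow> x \<in> I)"
    by (metis diff_zero)
  finally have inj: "inj_on (induced_map f J) (range (coset I)) \<longleftrightarrow> (\<forall>x. f x \<in> J \<longrightarrow> x \<in> I)" .
  have "range (\<lambda>x. coset J (f x)) = range (coset J) \<longleftrightarrow> (\<forall>y. \<exists>x. coset J y = coset J (f x))"
    (is "?L \<longleftrightarrow> ?R")
  proof
    show "?L \<Longrightarrow> ?R" by (metis rangeI imageE)
    show "?R \<Longrightarrow> ?L" by (intro equalityI image_subsetI) (auto simp: image_iff)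
  qed
  then have surj: "induced_map f J ` range (coset I) = range (coset J) \<longleftrightarrow>
      (\<forall>y. \<exists>x. y - f x \<in> J)"
    by (simp add: image_image ind B.coset_eq_iff[OF subJ])
  show ?thesis
    unfolding algebra_iso_def bij_betw_def carrier inj surj using hom by blast
qed

section \<open>Lie commutators\<close>

context leibniz_algebra
begin

lemma two_sided_ideal_UNIV: "two_sided_ideal scale bracket UNIV"
  by (simp add: two_sided_ideal_def)

lemma bracket_diff_left: "bracket (x - y) z = bracket x z - bracket y z"
  using bracket_add_left[of "x - y" y z] by simp

lemma bracket_diff_right: "bracket x (y - z) = bracket x y - bracket x z"
  using bracket_add_right[of x "y - z" z] by simp

lemma bracket_zero_left: "bracket 0 y = 0"
  using bracket_diff_left[of 0 0 y] by simp

lemma bracket_zero_right: "bracket x 0 = 0"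
  using bracket_diff_right[of x 0 0] by simp

lemma subspace_Lie_commutator: "subspace (Lie_commutator scale bracket M N)"
  by (simp add: Lie_commutator_def)

lemma Lie_commutatorI:
  "x \<in> M \<Longrightarrow> y \<in> N \<Longrightarrow> bracket x y + bracket y x \<in> Lie_commutator scale bracket M N"
  unfolding Lie_commutator_def by (rule span_base) auto

lemma Lie_commutator_mono:
  "M \<subseteq> M' \<Longrightarrow> N \<subseteq> N' \<Longrightarrow> Lie_commutator scale bracket M N \<subseteq> Lie_commutator scale bracket M' N'"
  unfolding Lie_commutator_def by (rule span_mono) blast

text \<open>Multiplication \<open>[-, z]\<close> from the right is a derivation, hence also a derivation of the
  symmetrised bracket, and \<open>[z, -]\<close> kills symmetrised brackets because the Leibniz identity is
  antisymmetric in its last two arguments.\<close>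

lemma two_sided_ideal_Lie_commutator:
  assumes M: "two_sided_ideal scale bracket M" and N: "two_sided_ideal scale bracket N"
  shows "two_sided_ideal scale bracket (Lie_commutator scale bracket M N)"
  unfolding two_sided_ideal_def
proof (intro conjI ballI allI)
  let ?L = "Lie_commutator scale bracket M N"
  show sub: "subspace ?L" by (rule subspace_Lie_commutator)
  fix u z assume u: "u \<in> ?L"
  show "bracket u z \<in> ?L"
    using u unfolding Lie_commutator_def
  proof (induction rule: span_induct_alt)
    case base
    then show ?case by (simp add: bracket_zero_left span_zero)
  next
    case (step c v w)
    then obtain x y where v: "v = bracket x y + bracket y x" and xy: "x \<in> M" "y \<in> N" by blast
    have "bracket v z = (bracket x (bracket y z) + bracket (bracket y z) x) +
        (bracket (bracket x z) y + bracket y (bracket x z))"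
      by (simp add: v bracket_add_left leibniz_identity algebra_simps)
    moreover have "\<dots> \<in> ?L"
      using xy M N by (intro subspace_add[OF sub] Lie_commutatorI) (auto simp: two_sided_ideal_def)
    ultimately show ?case
      using step.IH subspace_add[OF sub] subspace_scale[OF sub]
      by (simp add: bracket_add_left bracket_scale_left flip: Lie_commutator_def)
  qed
  have "bracket z u = 0"
    using u unfolding Lie_commutator_def
  proof (induction rule: span_induct_alt)
    case base
    then show ?case by (rule bracket_zero_right)
  next
    case (step c v w)
    then obtain x y where "v = bracket x y + bracket y x" by blast
    then have "bracket z v = 0"
      by (simp add: bracket_add_right leibniz_identity)
    then show ?case by (simp add: bracket_add_right bracket_scale_right step.IH)
  qed
  then show "bracket z u \<in> ?L" using subspace_0[OF sub] by simp
qed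

lemma two_sided_ideal_lower_Lie_central:
  assumes "two_sided_ideal scale bracket M"
  shows "two_sided_ideal scale bracket (lower_Lie_central scale bracket M k)"
proof (induction k rule: induct_nat_012)
  case (ge2 k)
  then show ?case by (simp add: two_sided_ideal_Lie_commutator two_sided_ideal_UNIV)
qed (simp_all add: assms two_sided_ideal_UNIV)

text \<open>Polarisation: \<open>[x,y] + [y,x] = [x+y,x+y] - [x,x] - [y,y]\<close>, and \<open>[x,x]\<close> is half of its own
  symmetrisation.\<close>

lemma leibniz_ann_eq_Lie_commutator:
  assumes "(2::'k) \<noteq> 0"
  shows "leibniz_ann scale bracket = Lie_commutator scale bracket UNIV UNIV"
proof
  have "bracket x x \<in> Lie_commutator scale bracket UNIV UNIV" for x
  proof -
    have "scale (1/2) (bracket x x + bracket x x) = scale (1/2 + 1/2) (bracket x x)"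
      by (simp only: scale_right_distrib scale_left_distrib)
    also have "1/2 + 1/2 = (1::'k)" using assms by (simp flip: add_divide_distrib)
    finally show ?thesis
      using Lie_commutatorI[of x UNIV x UNIV] subspace_scale[OF subspace_Lie_commutator]
      by (metis UNIV_I scale_one)
  qed
  then show "leibniz_ann scale bracket \<subseteq> Lie_commutator scale bracket UNIV UNIV"
    unfolding leibniz_ann_def by (intro span_minimal subspace_Lie_commutator) auto
next
  have sq: "bracket x x \<in> leibniz_ann scale bracket" for x
    unfolding leibniz_ann_def by (rule span_base) auto
  have sub: "subspace (leibniz_ann scale bracket)" by (simp add: leibniz_ann_def)
  have "bracket x y + bracket y x \<in> leibniz_ann scale bracket" for x y
  proof -
    have "bracket x y + bracket y x = bracket (x + y) (x + y) - bracket x x - bracket y y"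
      by (simp add: bracket_add_left bracket_add_right)
    then show ?thesis using sq subspace_diff[OF sub] by simp
  qed
  then show "Lie_commutator scale bracket UNIV UNIV \<subseteq> leibniz_ann scale bracket"
    unfolding Lie_commutator_def by (intro span_minimal sub) auto
qed

text \<open>The symmetrised bracket descends to a map on pairs modulo \<open>J\<close> with values modulo
  \<open>[J, UNIV]\<^sub>L\<^sub>i\<^sub>e\<close>: by bilinearity the difference is a sum of two symmetrised brackets, each with
  one entry in \<open>J\<close>.\<close>

lemma Lie_commutator_cong:
  assumes "x - x' \<in> J" "y - y' \<in> J"
  shows "(bracket x y + bracket y x) - (bracket x' y' + bracket y' x')
    \<in> Lie_commutator scale bracket J UNIV"
proof -
  have "(bracket x y + bracket y x) - (bracket x' y' + bracket y' x') =
      (bracket (x - x') y + bracket y (x - x')) + (bracket (y - y') x' + bracket x' (y - y'))"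
    by (simp add: bracket_diff_left bracket_diff_right)
  also have "\<dots> \<in> Lie_commutator scale bracket J UNIV"
    using assms by (intro subspace_add[OF subspace_Lie_commutator] Lie_commutatorI) auto
  finally show ?thesis .
qed

end

lemma leibniz_hom_compose:
  assumes "leibniz_hom s1 b1 s2 b2 f" "leibniz_hom s2 b2 s3 b3 g"
  shows "leibniz_hom s1 b1 s3 b3 (\<lambda>x. g (f x))"
  using assms Vector_Spaces.linear_compose[of s1 s2 f s3 g]
  unfolding leibniz_hom_def o_def by simp

lemma Lie_commutator_image:
  assumes "leibniz_hom s b s' b' f"
  shows "f ` Lie_commutator s b M N = Lie_commutator s' b' (f ` M) (f ` N)"
proof -
  interpret f: Vector_Spaces.linear s s' f using assms by (simp add: leibniz_hom_def)
  have "f ` {b x y + b y x | x y. x \<in> M \<and> y \<in> N} =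
      {b' x y + b' y x | x y. x \<in> f ` M \<and> y \<in> f ` N}" (is "?l = ?r")
  proof
    show "?l \<subseteq> ?r" using assms by (fastforce simp: leibniz_hom_def f.add)
    show "?r \<subseteq> ?l"
    proof safe
      fix x y assume "x \<in> M" "y \<in> N"
      moreover have "b' (f x) (f y) + b' (f y) (f x) = f (b x y + b y x)"
        using assms by (simp add: leibniz_hom_def f.add)
      ultimately show "b' (f x) (f y) + b' (f y) (f x) \<in> ?l" by blast
    qed
  qed
  then show ?thesis unfolding Lie_commutator_def by (simp flip: f.span_image)
qed

lemma lower_Lie_central_image:
  assumes q: "leibniz_algebra s' b'" and f: "leibniz_hom s b s' b' f" and mn: "f ` m \<subseteq> n"
  shows "f ` lower_Lie_central s b m k \<subseteq> lower_Lie_central s' b' n k"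
proof (induction k rule: induct_nat_012)
  case (ge2 k)
  then show ?case
    using leibniz_algebra.Lie_commutator_mono[OF q]
    by (simp add: Lie_commutator_image[OF f])
qed (simp_all add: mn)

lemma two_sided_ideal_vimage:
  assumes "leibniz_hom s b s' b' f" "two_sided_ideal s' b' J"
  shows "two_sided_ideal s b (f -` J)"
proof -
  interpret f: Vector_Spaces.linear s s' f using assms(1) by (simp add: leibniz_hom_def)
  show ?thesis
    using assms f.subspace_vimage[of J] by (simp add: two_sided_ideal_def leibniz_hom_def)
qed

text \<open>The entries of each generator of the commutator are replaced by elements of the image of \<open>f\<close>
  congruent to them modulo \<open>J\<close>. With surjectivity on \<open>HL\<^sub>1\<close> this gives the surjectivity half of
  the inductive step.\<close>

lemma Lie_commutator_lift:
  assumes q: "leibniz_algebra s' b'" and f: "leibniz_hom s b s' b' f"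
    and surj: "\<And>y. \<exists>x. y - f x \<in> J"
    and a: "a \<in> Lie_commutator s' b' UNIV UNIV"
  shows "\<exists>c\<in>Lie_commutator s b UNIV UNIV. a - f c \<in> Lie_commutator s' b' J UNIV"
proof -
  interpret q: leibniz_algebra s' b' by fact
  interpret f: Vector_Spaces.linear s s' f using f by (simp add: leibniz_hom_def)
  have sub: "f.vs1.subspace (Lie_commutator s b UNIV UNIV)" by (simp add: Lie_commutator_def)
  show ?thesis
    using a unfolding Lie_commutator_def[of s' b' UNIV]
  proof (induction rule: q.span_induct_alt)
    case base
    show ?case
      by (rule bexI[of _ 0])
        (simp_all add: sub f.vs1.subspace_0 q.subspace_0 q.subspace_Lie_commutator)
  next
    case (step k v w)
    then obtain y z where v: "v = b' y z + b' z y" by blast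
    obtain y' z' where yz: "y - f y' \<in> J" "z - f z' \<in> J" using surj by metis
    let ?v = "b y' z' + b z' y'"
    have v': "v - f ?v \<in> Lie_commutator s' b' J UNIV"
      using q.Lie_commutator_cong[OF yz] f by (simp add: v f.add leibniz_hom_def)
    obtain w' where w': "w' \<in> Lie_commutator s b UNIV UNIV"
      "w - f w' \<in> Lie_commutator s' b' J UNIV" using step.IH by blast
    have "s' k v + w - f (s k ?v + w') = s' k (v - f ?v) + (w - f w')"
      by (simp add: f.add f.scale q.scale_right_diff_distrib q.scale_right_distrib)
    also have "\<dots> \<in> Lie_commutator s' b' J UNIV"
      using v' w' q.subspace_add q.subspace_scale q.subspace_Lie_commutator by blast
    finally have "s' k v + w - f (s k ?v + w') \<in> Lie_commutator s' b' J UNIV" .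
    moreover have "?v \<in> Lie_commutator s b UNIV UNIV"
      unfolding Lie_commutator_def by (rule f.vs1.span_base) blast
    then have "s k ?v + w' \<in> Lie_commutator s b UNIV UNIV"
      using w' f.vs1.subspace_add[OF sub] f.vs1.subspace_scale[OF sub] by blast
    ultimately show ?case by blast
  qed
qed

text \<open>An instance of the well-definedness of the symmetrised bracket on pairs modulo \<open>S\<close>. It plays
  the role of a homotopy: it lets a lift of the identity be treated as the identity.\<close>

lemma (in leibniz_algebra) Lie_commutator_endo_cong:
  assumes f: "leibniz_hom scale bracket scale bracket f"
    and S: "\<And>x. f x - x \<in> S"
    and t: "t \<in> Lie_commutator scale bracket UNIV UNIV"
  shows "f t - t \<in> Lie_commutator scale bracket S UNIV"
proof -
  interpret f: Vector_Spaces.linear scale scale f using f by (simp add: leibniz_hom_def)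
  show ?thesis
    using t unfolding Lie_commutator_def[of _ _ UNIV]
  proof (induction rule: span_induct_alt)
    case base
    show ?case by (simp add: subspace_0 subspace_Lie_commutator)
  next
    case (step c v w)
    then obtain x y where v: "v = bracket x y + bracket y x" by blast
    have "f v - v \<in> Lie_commutator scale bracket S UNIV"
      using Lie_commutator_cong[OF S S, of x y] f by (simp add: v f.add leibniz_hom_def)
    moreover have "f (scale c v + w) - (scale c v + w) = scale c (f v - v) + (f w - w)"
      by (simp add: f.add f.scale scale_right_diff_distrib)
    ultimately show ?case
      using step.IH subspace_add subspace_scale subspace_Lie_commutator by metis
  qed
qed

section \<open>Free Leibniz algebras\<close>

lemma free_leibniz_induct [case_names gen zero add scale bracket]:
  fixes P :: "('k::field, 'x) free_leibniz \<Rightarrow> bool"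
  assumes "\<And>x. P (free_gen x)" "P 0" "\<And>t u. P t \<Longrightarrow> P u \<Longrightarrow> P (t + u)"
    "\<And>c t. P t \<Longrightarrow> P (free_scale c t)" "\<And>t u. P t \<Longrightarrow> P u \<Longrightarrow> P (free_bracket t u)"
  shows "P t"
proof (induct t rule: free_leibniz.abs_induct)
  case (1 t)
  show ?case
    by (induction t)
      (simp_all add: assms flip: free_gen.abs_eq zero_free_leibniz.abs_eq
        plus_free_leibniz.abs_eq free_scale.abs_eq free_bracket.abs_eq)
qed

text \<open>Projectivity of free algebras, relative to a map that is onto only modulo an ideal: a
  preimage modulo \<open>J\<close> is chosen for each generator.\<close>

lemma free_leibniz_section_mod:
  fixes f :: "'a::ab_group_add \<Rightarrow> ('k::field, 'y) free_leibniz"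
  assumes A: "leibniz_algebra s b"
    and f: "leibniz_hom s b free_scale free_bracket f"
    and J: "two_sided_ideal free_scale free_bracket J"
    and surj: "\<And>w. \<exists>x. w - f x \<in> J"
  shows "\<exists>\<psi>. leibniz_hom free_scale free_bracket s b \<psi> \<and> (\<forall>w. w - f (\<psi> w) \<in> J)"
proof -
  interpret F: leibniz_algebra "free_scale :: 'k \<Rightarrow> ('k, 'y) free_leibniz \<Rightarrow> _" free_bracket
    by (rule leibniz_algebra_free)
  interpret f: Vector_Spaces.linear s free_scale f using f by (simp add: leibniz_hom_def)
  have sub: "F.subspace J" using J by (simp add: two_sided_ideal_def)
  have "\<forall>y. \<exists>x. free_gen y - f x \<in> J" using surj by blast
  from choice[OF this] obtain h where h: "\<And>y. free_gen y - f (h y) \<in> J" by blast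
  obtain \<psi> where \<psi>: "leibniz_hom free_scale free_bracket s b \<psi>"
    and \<psi>_gen: "\<And>y. \<psi> (free_gen y) = h y"
    using ex1_implies_ex[OF free_leibniz_universal[OF A, of h]] by blast
  interpret p: Vector_Spaces.linear free_scale s \<psi> using \<psi> by (simp add: leibniz_hom_def)
  have "w - f (\<psi> w) \<in> J" for w
  proof (induction w rule: free_leibniz_induct)
    case (gen y)
    then show ?case by (simp add: \<psi>_gen h)
  next
    case zero
    then show ?case by (simp add: F.subspace_0[OF sub])
  next
    case (add t u)
    have "t + u - f (\<psi> (t + u)) = (t - f (\<psi> t)) + (u - f (\<psi> u))"
      by (simp add: p.add f.add)
    then show ?case using add F.subspace_add[OF sub] by metis
  next
    case (scale c t)
    have "free_scale c t - f (\<psi> (free_scale c t)) = free_scale c (t - f (\<psi> t))"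
      by (simp add: p.scale f.scale F.scale_right_diff_distrib)
    then show ?case using scale F.subspace_scale[OF sub] by metis
  next
    case (bracket t u)
    have "free_bracket t u - f (\<psi> (free_bracket t u)) =
        free_bracket (t - f (\<psi> t)) u + free_bracket (f (\<psi> t)) (u - f (\<psi> u))"
      using \<psi> f by (simp add: leibniz_hom_def F.bracket_diff_left F.bracket_diff_right)
    then show ?case using bracket J F.subspace_add[OF sub] by (simp add: two_sided_ideal_def)
  qed
  then show ?thesis using \<psi> by blast
qed

text \<open>Write \<open>A\<close> and \<open>F\<close> for the domain and codomain of \<open>f\<close>. When \<open>A\<close> is free too and \<open>S\<close> is the
  preimage of \<open>J\<close>, then \<open>f\<close> lifts an isomorphism \<open>A/S \<cong> F/J\<close> to free presentations, and this is
  the injectivity of the induced map on \<open>HL\<^sub>2\<close>. A section \<open>\<psi>\<close> of \<open>f\<close> modulo \<open>J\<close> lifts the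
  inverse isomorphism, so \<open>\<psi> \<circ> f\<close> is the identity modulo \<open>S\<close> and hence, on commutators, the
  identity modulo \<open>[S, A]\<^sub>L\<^sub>i\<^sub>e\<close>.\<close>

lemma Lie_commutator_reflect_free:
  fixes f :: "'a::ab_group_add \<Rightarrow> ('k::field, 'y) free_leibniz"
  assumes A: "leibniz_algebra s b"
    and f: "leibniz_hom s b free_scale free_bracket f"
    and J: "two_sided_ideal free_scale free_bracket J"
    and inj: "\<And>x. f x \<in> J \<Longrightarrow> x \<in> S"
    and surj: "\<And>w. \<exists>x. w - f x \<in> J"
    and t: "t \<in> Lie_commutator s b UNIV UNIV"
    and ft: "f t \<in> Lie_commutator free_scale free_bracket J UNIV"
  shows "t \<in> Lie_commutator s b S UNIV"
proof -
  interpret A: leibniz_algebra s b by fact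
  interpret F: leibniz_algebra "free_scale :: 'k \<Rightarrow> ('k, 'y) free_leibniz \<Rightarrow> _" free_bracket
    by (rule leibniz_algebra_free)
  interpret f: Vector_Spaces.linear s free_scale f using f by (simp add: leibniz_hom_def)
  have sub: "F.subspace J" using J by (simp add: two_sided_ideal_def)
  obtain \<psi> where \<psi>: "leibniz_hom free_scale free_bracket s b \<psi>"
    and sec: "\<And>w. w - f (\<psi> w) \<in> J"
    using free_leibniz_section_mod[OF A f J surj] by blast
  have "\<psi> w \<in> S" if "w \<in> J" for w
  proof (rule inj)
    have "f (\<psi> w) = w - (w - f (\<psi> w))" by simp
    then show "f (\<psi> w) \<in> J" using that sec F.subspace_diff[OF sub] by metis
  qed
  then have "Lie_commutator s b (\<psi> ` J) (range \<psi>) \<subseteq> Lie_commutator s b S UNIV"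
    by (intro A.Lie_commutator_mono) auto
  then have 1: "\<psi> (f t) \<in> Lie_commutator s b S UNIV"
    using ft Lie_commutator_image[OF \<psi>] by blast
  have "\<psi> (f x) - x \<in> S" for x
  proof (rule inj)
    have "f (\<psi> (f x) - x) = - (f x - f (\<psi> (f x)))" by (simp add: f.diff)
    then show "f (\<psi> (f x) - x) \<in> J" using sec F.subspace_neg[OF sub] by metis
  qed
  then have 2: "\<psi> (f t) - t \<in> Lie_commutator s b S UNIV"
    using A.Lie_commutator_endo_cong[OF leibniz_hom_compose[OF f \<psi>] _ t] by blast
  show ?thesis
    using A.subspace_diff[OF A.subspace_Lie_commutator 1 2] by simp
qed

lemma two_sided_ideal_presentation_kernel:
  assumes "leibniz_algebra s b" "leibniz_hom free_scale free_bracket s b \<epsilon>"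
  shows "two_sided_ideal free_scale free_bracket (presentation_kernel \<epsilon>)"
proof -
  interpret leibniz_algebra s b by fact
  have "two_sided_ideal s b {0}"
    by (simp add: two_sided_ideal_def bracket_zero_left bracket_zero_right)
  moreover have "presentation_kernel \<epsilon> = \<epsilon> -` {0}" by (auto simp: presentation_kernel_def)
  ultimately show ?thesis using two_sided_ideal_vimage[OF assms(2)] by simp
qed

lemma HL2_Lie_map_epiD:
  fixes \<epsilon>g :: "('k::field, 'x) free_leibniz \<Rightarrow> 'g::ab_group_add"
    and \<epsilon>q :: "('k, 'y) free_leibniz \<Rightarrow> 'q::ab_group_add"
  assumes g: "leibniz_algebra sg bg" and q: "leibniz_algebra sq bq"
    and \<phi>: "leibniz_hom sg bg sq bq \<phi>"
    and \<epsilon>g: "leibniz_hom free_scale free_bracket sg bg \<epsilon>g"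
    and \<epsilon>q: "leibniz_hom free_scale free_bracket sq bq \<epsilon>q"
    and lift: "presentation_lift \<epsilon>g \<epsilon>q \<phi> \<Phi>"
    and epi: "algebra_epi (HL2_Lie \<epsilon>g) (HL2_Lie \<epsilon>q) (HL2_Lie_map \<epsilon>q \<Phi>)"
    and u: "\<epsilon>q u = 0" "u \<in> Lie_commutator free_scale free_bracket UNIV UNIV"
  shows "\<exists>t. \<epsilon>g t = 0 \<and> t \<in> Lie_commutator free_scale free_bracket UNIV UNIV \<and>
    u - \<Phi> t \<in> Lie_commutator free_scale free_bracket (presentation_kernel \<epsilon>q) UNIV"
proof -
  interpret \<phi>: Vector_Spaces.linear sg sq \<phi> using \<phi> by (simp add: leibniz_hom_def)
  interpret Fg: leibniz_algebra "free_scale :: 'k \<Rightarrow> ('k, 'x) free_leibniz \<Rightarrow> _" free_bracket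
    by (rule leibniz_algebra_free)
  interpret Fq: leibniz_algebra "free_scale :: 'k \<Rightarrow> ('k, 'y) free_leibniz \<Rightarrow> _" free_bracket
    by (rule leibniz_algebra_free)
  let ?Rg = "presentation_kernel \<epsilon>g" and ?Rq = "presentation_kernel \<epsilon>q"
  let ?L = "Lie_commutator free_scale free_bracket ?Rg UNIV"
  let ?M = "Lie_commutator free_scale free_bracket ?Rq UNIV"
  have \<Phi>: "leibniz_hom free_scale free_bracket free_scale free_bracket \<Phi>"
    and comm: "\<And>t. \<epsilon>q (\<Phi> t) = \<phi> (\<epsilon>g t)"
    using lift by (auto simp: presentation_lift_def)
  have L: "two_sided_ideal free_scale free_bracket ?L"
    by (intro Fg.two_sided_ideal_Lie_commutator Fg.two_sided_ideal_UNIV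
        two_sided_ideal_presentation_kernel[OF g \<epsilon>g])
  have M: "two_sided_ideal free_scale free_bracket ?M"
    by (intro Fq.two_sided_ideal_Lie_commutator Fq.two_sided_ideal_UNIV
        two_sided_ideal_presentation_kernel[OF q \<epsilon>q])
  have "\<Phi> ` ?Rg \<subseteq> ?Rq"
    by (auto simp: presentation_kernel_def comm)
  then have LM: "\<Phi> ` ?L \<subseteq> ?M"
    unfolding Lie_commutator_image[OF \<Phi>] by (intro Fq.Lie_commutator_mono) auto
  have "coset ?M u \<in> carrier (HL2_Lie \<epsilon>q)"
    using u by (auto simp: HL2_Lie_def quotient_alg_def presentation_kernel_def)
  then have "coset ?M u \<in> HL2_Lie_map \<epsilon>q \<Phi> ` carrier (HL2_Lie \<epsilon>g)"
    using epi by (simp add: algebra_epi_def)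
  then obtain t where t: "\<epsilon>g t = 0" "t \<in> Lie_commutator free_scale free_bracket UNIV UNIV"
    and "coset ?M u = induced_map \<Phi> ?M (coset ?L t)"
    by (auto simp: HL2_Lie_def quotient_alg_def presentation_kernel_def HL2_Lie_map_def)
  then have "coset ?M u = coset ?M (\<Phi> t)"
    by (simp add: induced_map_coset[OF \<Phi> L M LM])
  then have "u - \<Phi> t \<in> ?M"
    by (simp add: Fq.coset_eq_iff[OF Fq.subspace_Lie_commutator])
  then show ?thesis using t by blast
qed

section \<open>The inductive step\<close>

text \<open>This is the injectivity half of the inductive step. A lift \<open>t\<close> of \<open>x\<close> to a commutator of the
  free algebra is known to satisfy \<open>\<epsilon>q (\<Phi> t) \<in> [J, q]\<^sub>L\<^sub>i\<^sub>e\<close> only. The epimorphism on \<open>HL\<^sub>2\<close> allows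
  \<open>t\<close> to be changed by a relation so that \<open>\<Phi> t\<close> itself becomes a commutator with the preimage of
  \<open>J\<close>. Then the same free algebras, as presentations of the quotients by \<open>I\<close> and \<open>J\<close>, satisfy the
  hypotheses of \<open>Lie_commutator_reflect_free\<close>.\<close>

lemma Lie_commutator_reflect:
  fixes \<epsilon>g :: "('k::field, 'x) free_leibniz \<Rightarrow> 'g::ab_group_add"
    and \<epsilon>q :: "('k, 'y) free_leibniz \<Rightarrow> 'q::ab_group_add"
  assumes g: "leibniz_algebra sg bg" and q: "leibniz_algebra sq bq"
    and \<phi>: "leibniz_hom sg bg sq bq \<phi>"
    and pres_g: "free_presentation sg bg \<epsilon>g" and pres_q: "free_presentation sq bq \<epsilon>q"
    and lift: "presentation_lift \<epsilon>g \<epsilon>q \<phi> \<Phi>"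
    and epi: "algebra_epi (HL2_Lie \<epsilon>g) (HL2_Lie \<epsilon>q) (HL2_Lie_map \<epsilon>q \<Phi>)"
    and J: "two_sided_ideal sq bq J"
    and inj: "\<And>x. \<phi> x \<in> J \<Longrightarrow> x \<in> I"
    and surj: "\<And>y. \<exists>x. y - \<phi> x \<in> J"
    and x: "x \<in> Lie_commutator sg bg UNIV UNIV"
    and \<phi>x: "\<phi> x \<in> Lie_commutator sq bq J UNIV"
  shows "x \<in> Lie_commutator sg bg I UNIV"
proof -
  interpret Fg: leibniz_algebra "free_scale :: 'k \<Rightarrow> ('k, 'x) free_leibniz \<Rightarrow> _" free_bracket
    by (rule leibniz_algebra_free)
  interpret Fq: leibniz_algebra "free_scale :: 'k \<Rightarrow> ('k, 'y) free_leibniz \<Rightarrow> _" free_bracket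
    by (rule leibniz_algebra_free)
  interpret g: leibniz_algebra sg bg by fact
  interpret q: leibniz_algebra sq bq by fact
  have \<epsilon>g: "leibniz_hom free_scale free_bracket sg bg \<epsilon>g" and "surj \<epsilon>g"
    and \<epsilon>q: "leibniz_hom free_scale free_bracket sq bq \<epsilon>q" and "surj \<epsilon>q"
    using pres_g pres_q by (auto simp: free_presentation_def)
  have \<Phi>: "leibniz_hom free_scale free_bracket free_scale free_bracket \<Phi>"
    and comm: "\<And>t. \<epsilon>q (\<Phi> t) = \<phi> (\<epsilon>g t)"
    using lift by (auto simp: presentation_lift_def)
  interpret eg: Vector_Spaces.linear free_scale sg \<epsilon>g using \<epsilon>g by (simp add: leibniz_hom_def)
  interpret eq: Vector_Spaces.linear free_scale sq \<epsilon>q using \<epsilon>q by (simp add: leibniz_hom_def)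
  interpret \<Phi>: Vector_Spaces.linear free_scale free_scale \<Phi> using \<Phi> by (simp add: leibniz_hom_def)
  let ?Fg = "Lie_commutator free_scale free_bracket UNIV UNIV :: ('k, 'x) free_leibniz set"
  let ?Fq = "Lie_commutator free_scale free_bracket UNIV UNIV :: ('k, 'y) free_leibniz set"
  let ?S = "\<epsilon>g -` I" and ?T = "\<epsilon>q -` J"
  let ?TF = "Lie_commutator free_scale free_bracket ?T UNIV"
  obtain t where t: "t \<in> ?Fg" "\<epsilon>g t = x"
    using x Lie_commutator_image[OF \<epsilon>g, of UNIV UNIV] \<open>surj \<epsilon>g\<close> by (metis imageE)
  \<comment> \<open>\<open>\<Phi> t\<close> and \<open>u\<close> are two lifts of \<open>\<phi> x\<close>, so they differ by a relation of \<open>q\<close>.\<close>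
  obtain u where u: "u \<in> ?TF" "\<epsilon>q u = \<phi> x"
    using \<phi>x Lie_commutator_image[OF \<epsilon>q, of ?T UNIV] \<open>surj \<epsilon>q\<close>
    by (metis imageE surj_image_vimage_eq)
  have TF: "?TF \<subseteq> ?Fq" by (rule Fq.Lie_commutator_mono) auto
  have "\<Phi> t \<in> ?Fq"
    using t(1) Lie_commutator_image[OF \<Phi>, of UNIV UNIV] Fq.Lie_commutator_mono[of "range \<Phi>" UNIV "range \<Phi>" UNIV]
    by blast
  then have "\<Phi> t - u \<in> ?Fq"
    using u TF Fq.subspace_diff[OF Fq.subspace_Lie_commutator] by blast
  moreover have "\<epsilon>q (\<Phi> t - u) = 0" by (simp add: eq.diff comm t u)
  ultimately obtain r where r: "\<epsilon>g r = 0" "r \<in> ?Fg"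
    and "\<Phi> t - u - \<Phi> r \<in> Lie_commutator free_scale free_bracket (presentation_kernel \<epsilon>q) UNIV"
    using HL2_Lie_map_epiD[OF g q \<phi> \<epsilon>g \<epsilon>q lift epi] by blast
  moreover have "presentation_kernel \<epsilon>q \<subseteq> ?T"
    using J q.subspace_0 by (auto simp: presentation_kernel_def two_sided_ideal_def)
  ultimately have "\<Phi> t - u - \<Phi> r \<in> ?TF"
    using Fq.Lie_commutator_mono by blast
  then have "(\<Phi> t - u - \<Phi> r) + u \<in> ?TF"
    using u Fq.subspace_add[OF Fq.subspace_Lie_commutator] by blast
  then have \<Phi>tr: "\<Phi> (t - r) \<in> ?TF" by (simp add: \<Phi>.diff)
  have "t - r \<in> Lie_commutator free_scale free_bracket ?S UNIV"
  proof (rule Lie_commutator_reflect_free[OF leibniz_algebra_free \<Phi> _ _ _ _ \<Phi>tr])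
    show "two_sided_ideal free_scale free_bracket ?T" by (rule two_sided_ideal_vimage[OF \<epsilon>q J])
    show "s \<in> ?S" if "\<Phi> s \<in> ?T" for s using that inj by (simp add: comm)
    show "\<exists>s. w - \<Phi> s \<in> ?T" for w
    proof -
      obtain y where "\<epsilon>q w - \<phi> y \<in> J" using surj by blast
      moreover obtain s where "\<epsilon>g s = y" using \<open>surj \<epsilon>g\<close> by (metis surjD)
      ultimately show ?thesis by (auto simp: eq.diff comm)
    qed
    show "t - r \<in> ?Fg"
      using t r Fg.subspace_diff[OF Fg.subspace_Lie_commutator] by blast
  qed
  then have "\<epsilon>g (t - r) \<in> Lie_commutator sg bg (\<epsilon>g ` ?S) (range \<epsilon>g)"
    using Lie_commutator_image[OF \<epsilon>g] by blast
  moreover have "\<epsilon>g ` ?S \<subseteq> I" by auto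
  ultimately have "\<epsilon>g (t - r) \<in> Lie_commutator sg bg I UNIV"
    using g.Lie_commutator_mono[of "\<epsilon>g ` ?S" I "range \<epsilon>g" UNIV] by (meson subsetD subset_UNIV)
  then show ?thesis by (simp add: eg.diff t r)
qed


theorem theorem6p2:
  fixes sg :: "'k::field \<Rightarrow> 'g::ab_group_add \<Rightarrow> 'g" and bg :: "'g \<Rightarrow> 'g \<Rightarrow> 'g"
    and sq :: "'k \<Rightarrow> 'q::ab_group_add \<Rightarrow> 'q" and bq :: "'q \<Rightarrow> 'q \<Rightarrow> 'q"
    and \<phi> :: "'g \<Rightarrow> 'q" and m :: "'g set" and n :: "'q set"
    and \<epsilon>g :: "('k, 'x) free_leibniz \<Rightarrow> 'g" and \<epsilon>q :: "('k, 'y) free_leibniz \<Rightarrow> 'q"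
    and \<Phi> :: "('k, 'x) free_leibniz \<Rightarrow> ('k, 'y) free_leibniz"
  assumes half: "(2::'k) \<noteq> 0"
    and g: "leibniz_algebra sg bg" and q: "leibniz_algebra sq bq"
    and hom: "leibniz_hom sg bg sq bq \<phi>"
    and m: "two_sided_ideal sg bg m" and n: "two_sided_ideal sq bq n"
    and mn: "\<phi> ` m \<subseteq> n"
    and pres_g: "free_presentation sg bg \<epsilon>g"
    and pres_q: "free_presentation sq bq \<epsilon>q"
    and lift: "presentation_lift \<epsilon>g \<epsilon>q \<phi> \<Phi>"
    and a: "algebra_iso (HL1_Lie sg bg) (HL1_Lie sq bq) (HL1_Lie_map sq bq \<phi>)"
    and b: "algebra_epi (HL2_Lie \<epsilon>g) (HL2_Lie \<epsilon>q) (HL2_Lie_map \<epsilon>q \<Phi>)"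
    and c: "algebra_iso (quotient_alg sg bg UNIV m) (quotient_alg sq bq UNIV n) (induced_map \<phi> n)"
  shows "\<forall>k\<ge>1.
    \<phi> ` lower_Lie_central sg bg m k \<subseteq> lower_Lie_central sq bq n k \<and>
    (\<forall>x. induced_map \<phi> (lower_Lie_central sq bq n k) (coset (lower_Lie_central sg bg m k) x) =
         coset (lower_Lie_central sq bq n k) (\<phi> x)) \<and>
    algebra_iso (quotient_alg sg bg UNIV (lower_Lie_central sg bg m k))
      (quotient_alg sq bq UNIV (lower_Lie_central sq bq n k))
      (induced_map \<phi> (lower_Lie_central sq bq n k))"
proof (intro allI impI)
  fix k :: nat assume "k \<ge> 1"
  interpret g: leibniz_algebra sg bg by fact
  interpret q: leibniz_algebra sq bq by fact
  interpret \<phi>: Vector_Spaces.linear sg sq \<phi> using hom by (simp add: leibniz_hom_def)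
  let ?mk = "lower_Lie_central sg bg m" and ?nk = "lower_Lie_central sq bq n"
  let ?gg = "Lie_commutator sg bg UNIV UNIV" and ?qq = "Lie_commutator sq bq UNIV UNIV"
  note mk = g.two_sided_ideal_lower_Lie_central[OF m]
    and nk = q.two_sided_ideal_lower_Lie_central[OF n]
    and mnk = lower_Lie_central_image[OF q hom mn]
  have gg: "two_sided_ideal sg bg ?gg"
    by (intro g.two_sided_ideal_Lie_commutator g.two_sided_ideal_UNIV)
  have qq: "two_sided_ideal sq bq ?qq"
    by (intro q.two_sided_ideal_Lie_commutator q.two_sided_ideal_UNIV)
  have gq: "\<phi> ` ?gg \<subseteq> ?qq"
    unfolding Lie_commutator_image[OF hom] by (intro q.Lie_commutator_mono) auto
  have "(\<forall>x. \<phi> x \<in> ?qq \<longrightarrow> x \<in> ?gg) \<and> (\<forall>y. \<exists>x. y - \<phi> x \<in> ?qq)"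
    using a algebra_iso_quotient_iff[OF g q hom gg qq gq]
    by (simp add: HL1_Lie_def HL1_Lie_map_def g.leibniz_ann_eq_Lie_commutator[OF half]
        q.leibniz_ann_eq_Lie_commutator[OF half])
  then have ab_inj: "\<And>x. \<phi> x \<in> ?qq \<Longrightarrow> x \<in> ?gg"
    and ab_surj: "\<And>y. \<exists>x. y - \<phi> x \<in> ?qq"
    by blast+
  have iso: "(\<forall>x. \<phi> x \<in> ?nk k \<longrightarrow> x \<in> ?mk k) \<and> (\<forall>y. \<exists>x. y - \<phi> x \<in> ?nk k)"
    using \<open>k \<ge> 1\<close>
  proof (induction k rule: dec_induct)
    case base
    then show ?case using c algebra_iso_quotient_iff[OF g q hom m n mn] by simp
  next
    case (step i)
    obtain j where j: "i = Suc j" using step.hyps by (cases i) auto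
    have inj: "\<And>x. \<phi> x \<in> ?nk i \<Longrightarrow> x \<in> ?mk i" and surj: "\<And>y. \<exists>x. y - \<phi> x \<in> ?nk i"
      using step.IH by blast+
    have "x \<in> Lie_commutator sg bg (?mk i) UNIV"
      if x: "\<phi> x \<in> Lie_commutator sq bq (?nk i) UNIV" for x
    proof -
      have "\<phi> x \<in> ?qq" using x q.Lie_commutator_mono[of "?nk i" UNIV UNIV UNIV] by blast
      then show ?thesis
        using Lie_commutator_reflect[OF g q hom pres_g pres_q lift b nk inj surj ab_inj x] by blast
    qed
    moreover have "\<exists>x. y - \<phi> x \<in> Lie_commutator sq bq (?nk i) UNIV" for y
    proof -
      obtain x where "y - \<phi> x \<in> ?qq" using ab_surj by blast
      then obtain z where "y - \<phi> x - \<phi> z \<in> Lie_commutator sq bq (?nk i) UNIV"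
        using Lie_commutator_lift[OF q hom surj] by blast
      moreover have "y - \<phi> x - \<phi> z = y - \<phi> (x + z)" by (simp add: \<phi>.add)
      ultimately show ?thesis by metis
    qed
    ultimately show ?case by (simp add: j)
  qed
  then show "\<phi> ` ?mk k \<subseteq> ?nk k \<and>
      (\<forall>x. induced_map \<phi> (?nk k) (coset (?mk k) x) = coset (?nk k) (\<phi> x)) \<and>
      algebra_iso (quotient_alg sg bg UNIV (?mk k)) (quotient_alg sq bq UNIV (?nk k))
        (induced_map \<phi> (?nk k))"
    using mnk induced_map_coset[OF hom mk nk mnk] algebra_iso_quotient_iff[OF g q hom mk nk mnk]
    by simp
qed

end
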